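(* Let $k$ and $\ell$ be two integers such that $k,\ell>1$. If $k$ and $\ell$ have the same parity, then the rectangular grid graph $G_{k,\ell}$ is balanceable.
   Context: All graphs are simple and finite. $G_{k,\ell}$ is the rectangular grid graph with $k$ vertices per row and $\ell$ vertices per column, i.e. the Cartesian product of a path on $k$ vertices and a path on $\ell$ vertices. A 2-coloring of the edges of $K_n$ is a function $\alpha:E(K_n)\to\{R,B\}$. It contains a balanced copy of a graph $G$ if $K_n$ has a (not necessarily induced) subgraph isomorphic to $G$ whose edge set is partitioned into $E_1,E_2$ with $\alpha(e)=R$ for $e\in E_1$, $\alpha(e)=B$ for $e\in E_2$, and $\big||E_1|-|E_2|\big|\le 1$. A graph $G$ is balanceable if there is an $n_0$ such that for every $n\ge n_0$ there exists an integer $m$ with $0\le m<\lfloor \frac12\binom n2\rfloor$ such that every 2-coloring $\alpha$ of $E(K_n)$ with $|\alpha^{-1}(R)|>m$ and $|\alpha^{-1}(B)|>m$ contains a balanced copy of $G$. *)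

theory Defs
  imports Complex_Main
begin

record 'a ugraph =
  verts :: "'a set"
  edges :: "'a set set"

definition simple_graph :: "'a ugraph \<Rightarrow> bool" where
  "simple_graph G \<longleftrightarrow>
     finite (verts G) \<and> (\<forall>e\<in>edges G. e \<subseteq> verts G \<and> card e = 2)"

definition subgraph :: "'a ugraph \<Rightarrow> 'a ugraph \<Rightarrow> bool" where
  "subgraph H G \<longleftrightarrow>
     simple_graph H \<and> simple_graph G \<and> verts H \<subseteq> verts G \<and> edges H \<subseteq> edges G"

definition isomorphic :: "'a ugraph \<Rightarrow> 'b ugraph \<Rightarrow> bool" where
  "isomorphic G H \<longleftrightarrow>
     (\<exists>f. bij_betw f (verts G) (verts H) \<and> edges H = (\<lambda>e. f ` e) ` edges G)"

definition complete_graph :: "nat \<Rightarrow> nat ugraph" where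
  "complete_graph n = \<lparr> verts = {..<n}, edges = {e. e \<subseteq> {..<n} \<and> card e = 2} \<rparr>"

definition path_graph :: "nat \<Rightarrow> nat ugraph" where
  "path_graph n = \<lparr> verts = {..<n}, edges = {{i, Suc i} | i. Suc i < n} \<rparr>"

definition cartesian_product :: "'a ugraph \<Rightarrow> 'b ugraph \<Rightarrow> ('a \<times> 'b) ugraph" where
  "cartesian_product G H =
     \<lparr> verts = verts G \<times> verts H,
       edges = {{(u, v), (u', v)} | u u' v. {u, u'} \<in> edges G \<and> v \<in> verts H}
             \<union> {{(u, v), (u, v')} | u v v'. u \<in> verts G \<and> {v, v'} \<in> edges H} \<rparr>"

definition grid_graph :: "nat \<Rightarrow> nat \<Rightarrow> (nat \<times> nat) ugraph" where
  "grid_graph k l = cartesian_product (path_graph k) (path_graph l)"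

datatype color = Red | Blue

text \<open>
  A 2-coloring of the edges of the complete graph on \<open>n\<close> vertices is represented by a total
  function on vertex sets; only its values on edges are ever used.
\<close>

definition color_class :: "nat \<Rightarrow> (nat set \<Rightarrow> color) \<Rightarrow> color \<Rightarrow> nat set set" where
  "color_class n \<alpha> c = {e \<in> edges (complete_graph n). \<alpha> e = c}"

definition contains_balanced_copy :: "nat \<Rightarrow> (nat set \<Rightarrow> color) \<Rightarrow> 'a ugraph \<Rightarrow> bool" where
  "contains_balanced_copy n \<alpha> G \<longleftrightarrow>
     (\<exists>H E1 E2. subgraph H (complete_graph n) \<and> isomorphic G H \<and>
        edges H = E1 \<union> E2 \<and> E1 \<inter> E2 = {} \<and>
        (\<forall>e\<in>E1. \<alpha> e = Red) \<and> (\<forall>e\<in>E2. \<alpha> e = Blue) \<and>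
        \<bar>int (card E1) - int (card E2)\<bar> \<le> 1)"

definition balanceable :: "'a ugraph \<Rightarrow> bool" where
  "balanceable G \<longleftrightarrow>
     (\<exists>n0. \<forall>n\<ge>n0. \<exists>m::nat. m < (n choose 2) div 2 \<and>
        (\<forall>\<alpha>. card (color_class n \<alpha> Red) > m \<and> card (color_class n \<alpha> Blue) > m \<longrightarrow>
             contains_balanced_copy n \<alpha> G))"

lemma simple_graph_complete_graph: "simple_graph (complete_graph n)"
  by (simp add: simple_graph_def complete_graph_def)

lemma simple_graph_path_graph: "simple_graph (path_graph n)"
  by (auto simp: simple_graph_def path_graph_def)

lemma simple_graph_cartesian_product:
  assumes "simple_graph G" "simple_graph H"
  shows "simple_graph (cartesian_product G H)"
proof -
  have G: "u \<in> verts G \<and> u' \<in> verts G \<and> u \<noteq> u'" if "{u, u'} \<in> edges G" for u u'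
    using assms(1) that by (fastforce simp: simple_graph_def)
  have H: "v \<in> verts H \<and> v' \<in> verts H \<and> v \<noteq> v'" if "{v, v'} \<in> edges H" for v v'
    using assms(2) that by (fastforce simp: simple_graph_def)
  have "finite (verts G \<times> verts H)"
    using assms by (simp add: simple_graph_def)
  then show ?thesis
    using G H by (auto simp: simple_graph_def cartesian_product_def card_insert_if)
qed

lemma simple_graph_grid_graph: "simple_graph (grid_graph k l)"
  by (simp add: grid_graph_def simple_graph_cartesian_product simple_graph_path_graph)

end

theory Submission
  imports Defs "HOL-Library.Ramsey"
begin

text \<open>
  Let \<open>W\<close> be an independent set of a graph meeting exactly half of its edges. Any colouring with
  a clique \<open>A\<close> of one colour that is joined completely to a set \<open>B\<close> in the other colour contains
  a balanced copy of the graph: place \<open>W\<close> in \<open>B\<close> and everything else in \<open>A\<close>. Only the edges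
  inside \<open>A\<close> and between \<open>A\<close> and \<open>B\<close> are used.

  Such a pair \<open>A, B\<close> exists whenever both colours have quadratically many edges. Linearly many
  vertices have linear blue degree, and Ramsey's theorem gives a large monochromatic clique among
  them. If it is red, linearly many vertices have many blue neighbours in it, and the pigeonhole
  principle selects \<open>B\<close>. The same argument with the colours exchanged leaves only the case of a
  large blue and a large red clique, where the pigeonhole principle is applied between the two.

  In a grid whose sides have the same parity, rotation by 180 degrees preserves both
  bipartition classes, and one of them contains no fixed point. Choose for \<open>W\<close> one vertex from each orbit in
  this class. Every edge has exactly one end in the class, so the rotation exchanges the edges
  meeting \<open>W\<close> with the edges avoiding it.
\<close>

section \<open>Unavoidable patterns\<close>

definition mono_clique :: "(nat set \<Rightarrow> color) \<Rightarrow> color \<Rightarrow> nat set \<Rightarrow> bool" where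
  "mono_clique \<alpha> c A \<longleftrightarrow> (\<forall>a\<in>A. \<forall>b\<in>A. a \<noteq> b \<longrightarrow> \<alpha> {a, b} = c)"

definition split_pattern :: "(nat set \<Rightarrow> color) \<Rightarrow> nat \<Rightarrow> nat \<Rightarrow> bool" where
  "split_pattern \<alpha> n t \<longleftrightarrow>
     (\<exists>c A B. A \<subseteq> {..<n} \<and> B \<subseteq> {..<n} \<and> A \<inter> B = {} \<and> card A = t \<and> card B = t \<and>
        mono_clique \<alpha> c A \<and> (\<forall>a\<in>A. \<forall>b\<in>B. \<alpha> {a, b} \<noteq> c))"

lemma mono_clique_subset: "mono_clique \<alpha> c A \<Longrightarrow> B \<subseteq> A \<Longrightarrow> mono_clique \<alpha> c B"
  unfolding mono_clique_def by blast

lemma ramsey_mono_clique: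
  "\<exists>r. \<forall>V \<alpha>. finite V \<and> r \<le> card V \<longrightarrow>
    (\<exists>A c. A \<subseteq> V \<and> card A = s \<and> mono_clique \<alpha> c A)"
proof -
  obtain r where r: "\<forall>(V::nat set) (E::nat set set). finite V \<and> r \<le> card V \<longrightarrow>
      (\<exists>R\<subseteq>V. card R = s \<and> clique R E \<or> card R = s \<and> indep R E)"
    using ramsey2[of s s] by blast
  have "\<exists>A c. A \<subseteq> V \<and> card A = s \<and> mono_clique \<alpha> c A"
    if V: "finite V" "r \<le> card V" for V \<alpha>
  proof -
    \<comment> \<open>Ramsey's theorem is applied to the graph of red edges, whose independent sets
      are the blue cliques.\<close>
    obtain R where R: "R \<subseteq> V" "card R = s"
      "clique R {e. \<alpha> e = Red} \<or> indep R {e. \<alpha> e = Red}"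
      using r V by blast
    have "c \<noteq> Red \<longleftrightarrow> c = Blue" for c by (cases c) auto
    then have "mono_clique \<alpha> Red R \<or> mono_clique \<alpha> Blue R"
      using R(3) by (simp add: clique_def indep_def mono_clique_def)
    with R show ?thesis by blast
  qed
  then show ?thesis by (intro exI[of _ r] allI impI) simp
qed

section \<open>Pigeonhole and degree counting\<close>

text \<open>Sort \<open>Z\<close> by neighbourhoods in \<open>A\<close>. There are only
  \<open>2 ^ card A\<close> of them, so some \<open>t\<close> elements share the same one, and
  richness lets \<open>t\<close> elements be chosen from it.\<close>

lemma common_neighbourhood:
  assumes fin: "finite A" "finite Z" and "t \<ge> 1"
    and rich: "\<And>z. z \<in> Z \<Longrightarrow> t \<le> card {a\<in>A. R a z}"
    and large: "t * 2 ^ card A \<le> card Z"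
  shows "\<exists>A' B. A' \<subseteq> A \<and> B \<subseteq> Z \<and> card A' = t \<and> card B = t \<and> (\<forall>a\<in>A'. \<forall>b\<in>B. R a b)"
proof -
  define F where "F S = {z\<in>Z. {a\<in>A. R a z} = S}" for S
  have "\<exists>S\<in>Pow A. t \<le> card (F S)"
  proof (rule ccontr)
    assume no: "\<not> ?thesis"
    have small: "card (F S) \<le> t - 1" if "S \<in> Pow A" for S
    proof -
      have "\<not> t \<le> card (F S)" using no that by blast
      then show ?thesis by linarith
    qed
    have "Z \<subseteq> (\<Union>S\<in>Pow A. F S)"
    proof
      fix z assume "z \<in> Z"
      then have "z \<in> F {a\<in>A. R a z}" by (simp add: F_def)
      moreover have "{a\<in>A. R a z} \<in> Pow A" by blast
      ultimately show "z \<in> (\<Union>S\<in>Pow A. F S)" by (rule UN_I[rotated])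
    qed
    then have "card Z \<le> card (\<Union>S\<in>Pow A. F S)"
      by (intro card_mono) (use fin in \<open>auto simp: F_def\<close>)
    also have "\<dots> \<le> (\<Sum>S\<in>Pow A. card (F S))"
      using fin by (intro card_UN_le) auto
    also have "\<dots> \<le> (\<Sum>S\<in>Pow A. t - 1)"
      by (intro sum_mono small)
    also have "\<dots> = 2 ^ card A * (t - 1)"
      using fin by (simp add: card_Pow)
    also have "\<dots> < t * 2 ^ card A"
      using \<open>t \<ge> 1\<close> by simp
    finally show False using large by simp
  qed
  then obtain S where S: "S \<subseteq> A" "t \<le> card (F S)" by auto
  then obtain B where B: "B \<subseteq> F S" "card B = t"
    using obtain_subset_with_card_n by metis
  \<comment> \<open>Richness is assumed for elements of \<open>Z\<close> only; a member of the
    nonempty \<open>B\<close> transfers it to the shared neighbourhood \<open>S\<close>.\<close>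
  then obtain z where "z \<in> B" using \<open>t \<ge> 1\<close> by (cases "B = {}") auto
  then have "z \<in> Z" "{a\<in>A. R a z} = S" using B by (auto simp: F_def)
  then have "t \<le> card S" using rich by auto
  then obtain A' where "A' \<subseteq> S" "card A' = t"
    using obtain_subset_with_card_n by metis
  then show ?thesis using S B by (intro exI[of _ A'] exI[of _ B]) (auto simp: F_def)
qed

text \<open>A rich index contributes at most \<open>card J\<close>, any other less than
  \<open>d\<close>; charging \<open>d\<close> to every index keeps the bound simple.\<close>

lemma sum_card_le_rich:
  assumes "finite I" "finite J"
  shows "(\<Sum>i\<in>I. card {j\<in>J. P i j})
    \<le> card {i\<in>I. d \<le> card {j\<in>J. P i j}} * card J + card I * d"
proof -
  have "(\<Sum>i\<in>I. card {j\<in>J. P i j})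
      \<le> (\<Sum>i\<in>I. (if d \<le> card {j\<in>J. P i j} then card J else 0) + d)"
    using assms by (intro sum_mono) (auto intro!: trans_le_add1 card_mono)
  also have "\<dots> = card {i\<in>I. d \<le> card {j\<in>J. P i j}} * card J + card I * d"
    using assms by (simp add: sum.distrib sum.If_cases Int_def)
  finally show ?thesis .
qed

lemma card_color_class_le:
  "card (color_class n \<alpha> c) \<le> (\<Sum>v<n. card {u\<in>{..<n}. u \<noteq> v \<and> \<alpha> {u, v} = c})"
proof -
  let ?S = "SIGMA v:{..<n}. {u\<in>{..<n}. u \<noteq> v \<and> \<alpha> {u, v} = c}"
  have "color_class n \<alpha> c \<subseteq> (\<lambda>(v, u). {u, v}) ` ?S"
  proof
    fix e assume e: "e \<in> color_class n \<alpha> c"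
    then obtain u v where "e = {u, v}" "u \<noteq> v"
      by (auto simp: color_class_def complete_graph_def card_2_iff)
    then show "e \<in> (\<lambda>(v, u). {u, v}) ` ?S"
      using e by (intro image_eqI[of _ _ "(v, u)"]) (auto simp: color_class_def complete_graph_def)
  qed
  then have "card (color_class n \<alpha> c) \<le> card ?S"
    by (intro surj_card_le) auto
  then show ?thesis by simp
qed

text \<open>The degree sum is at least about \<open>n * n / 4\<close>, while degrees below
  \<open>n div 16\<close> account for at most \<open>n * n / 16\<close> of it. The slack absorbs the
  rounding once \<open>n \<ge> 8\<close>.\<close>

lemma many_vertices_of_large_degree:
  assumes half: "(n choose 2) div 2 \<le> card (color_class n \<alpha> c)" and n: "n \<ge> 8"
  shows "n \<le> 16 * card {v\<in>{..<n}. n div 16 \<le> card {u\<in>{..<n}. u \<noteq> v \<and> \<alpha> {u, v} = c}}"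
    (is "_ \<le> 16 * ?X")
proof -
  have "(n choose 2) div 2 \<le> ?X * n + n * (n div 16)"
    using half card_color_class_le[of n \<alpha> c]
      sum_card_le_rich[of "{..<n}" "{..<n}" "\<lambda>v u. u \<noteq> v \<and> \<alpha> {u, v} = c" "n div 16"]
    by simp
  \<comment> \<open>The two halvings amount to a division by 4, with remainder at most 3.\<close>
  moreover have "n * (n - 1) \<le> 4 * ((n choose 2) div 2) + 3"
    unfolding choose_two by presburger
  moreover have "n * (n div 16) * 16 \<le> n * n"
    by (simp add: mult.assoc)
  moreover have "n * (n - 1) = n * n - n"
    by (simp add: diff_mult_distrib2)
  moreover have "8 * n \<le> n * n" using n by simp
  ultimately have "n * n \<le> 16 * (?X * n)"
    using n by linarith
  then have "n * n \<le> n * (16 * ?X)" by (simp only: ac_simps)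
  then show ?thesis using n by simp
qed

section \<open>Split patterns from monochromatic cliques\<close>

text \<open>Double counting: the clique sends out about \<open>2 * t * n\<close> edges of the other
  colour, and vertices outside \<open>Z\<close> receive at most \<open>t * n\<close> of them. As
  each vertex receives at most \<open>32 * t\<close>, \<open>Z\<close> has about
  \<open>n / 32\<close> elements.\<close>

lemma split_pattern_of_clique:
  assumes "t \<ge> 1" and A: "A \<subseteq> {..<n}" "mono_clique \<alpha> c A" "card A = 32 * t"
    and deg: "\<And>a. a \<in> A \<Longrightarrow> n div 16 \<le> card {u\<in>{..<n}. u \<noteq> a \<and> \<alpha> {u, a} \<noteq> c}"
    and n: "32 * (t * 2 ^ (32 * t) + 1) \<le> n"
  shows "split_pattern \<alpha> n t"
proof -
  let ?R = "\<lambda>a u. u \<noteq> a \<and> \<alpha> {u, a} \<noteq> c"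
  define Z where "Z = {u\<in>{..<n}. t \<le> card {a\<in>A. ?R a u}}"
  have fin: "finite A" using A finite_subset by blast
  have "32 * t * (n div 16) \<le> (\<Sum>a\<in>A. card {u\<in>{..<n}. ?R a u})"
    using sum_bounded_below[of A "n div 16" "\<lambda>a. card {u\<in>{..<n}. ?R a u}"] deg A by simp
  also have "\<dots> = (\<Sum>u<n. card {a\<in>A. ?R a u})"
    using fin by (intro sum_multicount_gen) auto
  also have "\<dots> \<le> card Z * card A + n * t"
    using sum_card_le_rich[of "{..<n}" A "\<lambda>u a. ?R a u" t] fin by (simp add: Z_def)
  finally have "t * (32 * (n div 16)) \<le> t * (card Z * 32 + n)"
    using A by (simp add: algebra_simps)
  then have "32 * (n div 16) \<le> card Z * 32 + n" using \<open>t \<ge> 1\<close> by simp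
  \<comment> \<open>The \<open>+ 1\<close> in the bound on \<open>n\<close> pays for the rounding in
    \<open>n div 16\<close>.\<close>
  then have "t * 2 ^ card A \<le> card Z" using n A by simp
  moreover have "finite Z" by (simp add: Z_def)
  moreover have "t \<le> card {a\<in>A. ?R a u}" if "u \<in> Z" for u using that by (simp add: Z_def)
  ultimately obtain A' B where AB: "A' \<subseteq> A" "B \<subseteq> Z" "card A' = t" "card B = t"
    "\<forall>a\<in>A'. \<forall>b\<in>B. ?R a b"
    using common_neighbourhood[of A Z t ?R] fin \<open>t \<ge> 1\<close> by blast
  moreover have "B \<subseteq> {..<n}" using AB by (auto simp: Z_def)
  moreover have "mono_clique \<alpha> c A'" using A(2) AB(1) by (rule mono_clique_subset)
  \<comment> \<open>Disjointness of \<open>A'\<close> and \<open>B\<close> comes from the conjunct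
    \<open>u \<noteq> a\<close> of \<open>?R\<close>.\<close>
  ultimately show ?thesis
    using A unfolding split_pattern_def
    by (intro exI[of _ c] exI[of _ A'] exI[of _ B]) (auto simp: insert_commute)
qed

text \<open>Each vertex of \<open>D\<close> outside a \<open>2 * t\<close>-subset \<open>P\<close>
  of \<open>A\<close> sends \<open>t\<close> edges to \<open>P\<close> that all have colour
  \<open>c\<close> or all avoid it. The more frequent case decides which of the two cliques supplies
  the clique of the pattern.\<close>

lemma split_pattern_of_two_cliques:
  assumes "t \<ge> 1" "c \<noteq> d"
    and A: "A \<subseteq> {..<n}" "mono_clique \<alpha> c A" "2 * t + 1 \<le> card A"
    and D: "D \<subseteq> {..<n}" "mono_clique \<alpha> d D" "2 * (t * 2 ^ (2 * t)) + 2 * t \<le> card D"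
  shows "split_pattern \<alpha> n t"
proof -
  have fin: "finite A" "finite D" using A D finite_subset by blast+
  have "2 * t \<le> card A" using A by simp
  then obtain P where P: "P \<subseteq> A" "card P = 2 * t"
    using obtain_subset_with_card_n by metis
  have finP: "finite P" using P fin finite_subset by blast
  define Z where "Z = D - P"
  let ?R = "\<lambda>a u. \<alpha> {a, u} \<noteq> c" let ?Q = "\<lambda>a u. \<alpha> {a, u} = c"
  define Z1 where "Z1 = {u\<in>Z. t \<le> card {a\<in>P. ?R a u}}"
  define Z2 where "Z2 = {u\<in>Z. t \<le> card {a\<in>P. ?Q a u}}"
  have finZ: "finite Z" "finite Z1" "finite Z2"
    using fin by (auto simp: Z_def Z1_def Z2_def)
  have "t \<le> card {a\<in>P. ?R a u} \<or> t \<le> card {a\<in>P. ?Q a u}" for u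
  proof -
    have "card {a\<in>P. ?R a u} + card {a\<in>P. ?Q a u} = card ({a\<in>P. ?R a u} \<union> {a\<in>P. ?Q a u})"
      using finP by (intro card_Un_disjoint[symmetric]) auto
    also have "{a\<in>P. ?R a u} \<union> {a\<in>P. ?Q a u} = P" by auto
    finally show ?thesis using P by linarith
  qed
  then have "Z \<subseteq> Z1 \<union> Z2" by (auto simp: Z1_def Z2_def)
  then have "card Z \<le> card Z1 + card Z2"
    using finZ by (meson card_Un_le card_mono finite_UnI le_trans)
  moreover have "card D - card P \<le> card Z"
    using finP unfolding Z_def by (rule diff_card_le_card_Diff)
  ultimately have "t * 2 ^ card P \<le> card Z1 \<or> t * 2 ^ card P \<le> card Z2"
    using D P by auto
  then show ?thesis
  proof
    assume "t * 2 ^ card P \<le> card Z1"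
    moreover have "t \<le> card {a\<in>P. ?R a u}" if "u \<in> Z1" for u
      using that by (simp add: Z1_def)
    ultimately obtain A' B where AB: "A' \<subseteq> P" "B \<subseteq> Z1" "card A' = t" "card B = t"
      "\<forall>a\<in>A'. \<forall>b\<in>B. ?R a b"
      using common_neighbourhood[OF finP finZ(2) \<open>t \<ge> 1\<close>, of ?R] by blast
    moreover have "A' \<subseteq> {..<n}" "B \<subseteq> {..<n}" "A' \<inter> B = {}"
      using AB(1,2) A(1) D(1) P(1) unfolding Z1_def Z_def by blast+
    moreover have "mono_clique \<alpha> c A'"
      using A(2) by (rule mono_clique_subset) (use AB(1) P(1) in blast)
    ultimately show ?thesis unfolding split_pattern_def
      by (intro exI[of _ c] exI[of _ A'] exI[of _ B] conjI)
  next
    assume "t * 2 ^ card P \<le> card Z2"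
    moreover have "t \<le> card {a\<in>P. ?Q a u}" if "u \<in> Z2" for u
      using that by (simp add: Z2_def)
    \<comment> \<open>Roles are exchanged: the clique side now lies in \<open>D\<close>, with colour
      \<open>d\<close>, and the cross edges have colour \<open>c\<close>.\<close>
    ultimately obtain B A' where AB: "B \<subseteq> P" "A' \<subseteq> Z2" "card A' = t" "card B = t"
      "\<forall>a\<in>B. \<forall>b\<in>A'. ?Q a b"
      using common_neighbourhood[OF finP finZ(3) \<open>t \<ge> 1\<close>, of ?Q] by blast
    moreover have "A' \<subseteq> {..<n}" "B \<subseteq> {..<n}" "A' \<inter> B = {}" "A' \<subseteq> D"
      using AB(1,2) A(1) D(1) P(1) unfolding Z2_def Z_def by blast+
    moreover have "mono_clique \<alpha> d A'"
      using D(2) \<open>A' \<subseteq> D\<close> by (rule mono_clique_subset)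
    moreover have "\<forall>a\<in>A'. \<forall>b\<in>B. \<alpha> {a, b} \<noteq> d"
      using AB(5) \<open>c \<noteq> d\<close> by (metis insert_commute)
    ultimately show ?thesis unfolding split_pattern_def
      by (intro exI[of _ d] exI[of _ A'] exI[of _ B] conjI)
  qed
qed

lemma split_pattern_unavoidable:
  assumes "t \<ge> 1"
  shows "\<exists>n0. \<forall>n\<ge>n0. \<forall>\<alpha>. (\<forall>c. (n choose 2) div 2 \<le> card (color_class n \<alpha> c)) \<longrightarrow>
    split_pattern \<alpha> n t"
proof -
  \<comment> \<open>Large enough for both constructions: \<open>32 * t\<close> for one clique, the
    rest for two.\<close>
  define s where "s = 32 * t + 2 * (t * 2 ^ (2 * t)) + 2 * t"
  obtain r where r: "\<And>V \<alpha>. finite V \<Longrightarrow> r \<le> card V \<Longrightarrow>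
      \<exists>A c. A \<subseteq> V \<and> card A = s \<and> mono_clique \<alpha> c A"
    using ramsey_mono_clique[of s] by metis
  have "split_pattern \<alpha> n t"
    if n: "n \<ge> 16 * r + 32 * (t * 2 ^ (32 * t) + 1)"
      and half: "\<And>c. (n choose 2) div 2 \<le> card (color_class n \<alpha> c)" for n \<alpha>
  proof -
    define X where
      "X c = {v\<in>{..<n}. n div 16 \<le> card {u\<in>{..<n}. u \<noteq> v \<and> \<alpha> {u, v} = c}}" for c
    \<comment> \<open>A Ramsey clique inside \<open>X c\<close> must have colour \<open>c\<close>:
      otherwise the large \<open>c\<close>-degrees of its vertices would give a split
      pattern.\<close>
    have clique: "\<exists>A. A \<subseteq> {..<n} \<and> card A = s \<and> mono_clique \<alpha> c A"
      if no: "\<not> split_pattern \<alpha> n t" for c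
    proof -
      have "n \<le> 16 * card (X c)"
        using many_vertices_of_large_degree[OF half, of c] n by (simp add: X_def)
      then have "r \<le> card (X c)" using n by linarith
      moreover have "finite (X c)" by (simp add: X_def)
      ultimately obtain A d where A: "A \<subseteq> X c" "card A = s" "mono_clique \<alpha> d A"
        using r by blast
      have "d = c"
      proof (rule ccontr)
        assume "d \<noteq> c"
        then have dc: "x \<noteq> d \<longleftrightarrow> x = c" for x
          by (cases x; cases c; cases d) auto
        have "32 * t \<le> card A" using A by (simp add: s_def)
        then obtain A' where A': "A' \<subseteq> A" "card A' = 32 * t"
          using obtain_subset_with_card_n by metis
        have "split_pattern \<alpha> n t"
        proof (rule split_pattern_of_clique)
          show "A' \<subseteq> {..<n}" using A A' by (auto simp: X_def)
          show "mono_clique \<alpha> d A'" using A(3) A'(1) by (rule mono_clique_subset)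
          show "n div 16 \<le> card {u\<in>{..<n}. u \<noteq> a \<and> \<alpha> {u, a} \<noteq> d}" if "a \<in> A'" for a
            using that A(1) A'(1) unfolding dc X_def by blast
        qed (use n A' assms in auto)
        with no show False ..
      qed
      with A show ?thesis by (auto simp: X_def)
    qed
    show ?thesis
    proof (rule ccontr)
      assume no: "\<not> ?thesis"
      obtain A where "A \<subseteq> {..<n}" "card A = s" "mono_clique \<alpha> Red A"
        using clique[OF no] by blast
      moreover obtain D where "D \<subseteq> {..<n}" "card D = s" "mono_clique \<alpha> Blue D"
        using clique[OF no] by blast
      ultimately have "split_pattern \<alpha> n t"
        using split_pattern_of_two_cliques[of t Red Blue A n \<alpha> D] assms by (simp add: s_def)
      with no show False ..
    qed
  qed
  then show ?thesis by blast
qed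

section \<open>Independent sets meeting half of the edges\<close>

text \<open>Since \<open>W\<close> is independent, an edge meeting it lands between \<open>A\<close>
  and \<open>B\<close>; all others land inside \<open>A\<close>. So the colour of an edge tells
  whether it meets \<open>W\<close>.\<close>

lemma balanced_copy_of_split_pattern:
  assumes G: "simple_graph G"
    and W: "W \<subseteq> verts G" "\<And>e. e \<in> edges G \<Longrightarrow> \<not> e \<subseteq> W"
    and half: "card {e\<in>edges G. e \<inter> W \<noteq> {}} = card {e\<in>edges G. e \<inter> W = {}}"
    and pat: "split_pattern \<alpha> n t" "card (verts G) \<le> t"
  shows "contains_balanced_copy n \<alpha> G"
proof -
  obtain c A B where AB: "A \<subseteq> {..<n}" "B \<subseteq> {..<n}" "A \<inter> B = {}" "card A = t" "card B = t"
      "mono_clique \<alpha> c A" "\<And>a b. a \<in> A \<Longrightarrow> b \<in> B \<Longrightarrow> \<alpha> {a, b} \<noteq> c"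
    using pat unfolding split_pattern_def by blast
  have finV: "finite (verts G)" and E: "\<And>e. e \<in> edges G \<Longrightarrow> e \<subseteq> verts G \<and> card e = 2"
    using G by (auto simp: simple_graph_def)
  have finAB: "finite A" "finite B" using AB finite_subset by blast+
  have "card W \<le> card B" "card (verts G - W) \<le> card A"
    using AB pat W finV card_mono[of "verts G" W] card_mono[of "verts G" "verts G - W"] by auto
  then obtain g h where g: "g ` W \<subseteq> B" "inj_on g W"
    and h: "h ` (verts G - W) \<subseteq> A" "inj_on h (verts G - W)"
    using card_le_inj[of W B] card_le_inj[of "verts G - W" A] finV finAB W finite_subset
    by (metis finite_Diff)
  \<comment> \<open>The two injections glue to one because \<open>A\<close> and \<open>B\<close> are
    disjoint.\<close>
  define f where "f v = (if v \<in> W then g v else h v)" for v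
  have fB: "f v \<in> B" if "v \<in> W" for v using that g by (auto simp: f_def)
  have fA: "f v \<in> A" if "v \<in> verts G" "v \<notin> W" for v using that h by (auto simp: f_def)
  have inj: "inj_on f (verts G)"
  proof (rule inj_onI)
    fix u v assume uv: "u \<in> verts G" "v \<in> verts G" "f u = f v"
    then have "u \<in> W \<longleftrightarrow> v \<in> W" using fA fB AB(3) by (metis disjoint_iff)
    then show "u = v" using uv g h by (auto simp: f_def dest: inj_onD split: if_splits)
  qed
  have injE: "inj_on ((`) f) (edges G)"
    using E inj by (intro inj_on_subset[OF inj_on_image_Pow[OF inj]]) auto
  define H where "H = \<lparr>verts = f ` verts G, edges = (`) f ` edges G\<rparr>"
  have fn: "f ` verts G \<subseteq> {..<n}" using fA fB AB by blast
  have card2: "card (f ` e) = 2" if "e \<in> edges G" for e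
    using E[OF that] inj by (metis card_image inj_on_subset)
  have sub: "subgraph H (complete_graph n)"
    using fn E card2 finV
    by (auto simp: subgraph_def simple_graph_def H_def complete_graph_def subset_iff image_iff; blast)
  have iso: "isomorphic G H"
    using inj by (auto simp: isomorphic_def H_def bij_betw_def)
  define M where "M = (`) f ` {e\<in>edges G. e \<inter> W \<noteq> {}}"
  define N where "N = (`) f ` {e\<in>edges G. e \<inter> W = {}}"
  have union: "edges H = M \<union> N" by (auto simp: H_def M_def N_def)
  have disj: "M \<inter> N = {}"
    using injE unfolding M_def N_def by (auto dest: inj_onD)
  have card_eq: "card M = card N"
    unfolding M_def N_def using half injE
    by (simp add: card_image inj_on_subset)
  have colN: "\<alpha> e = c" if "e \<in> N" for e
  proof -
    obtain e0 where e0: "e0 \<in> edges G" "e0 \<inter> W = {}" "e = f ` e0" using \<open>e \<in> N\<close> by (auto simp: N_def)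
    obtain u v where uv: "e = {u, v}" "u \<noteq> v" using card2[OF e0(1)] e0(3) by (auto simp: card_2_iff)
    have "e \<subseteq> A" using e0 E fA by blast
    then show ?thesis using uv AB(6) by (auto simp: mono_clique_def)
  qed
  have colM: "\<alpha> e \<noteq> c" if "e \<in> M" for e
  proof -
    obtain e0 where e0: "e0 \<in> edges G" "e0 \<inter> W \<noteq> {}" "e = f ` e0" using \<open>e \<in> M\<close> by (auto simp: M_def)
    then obtain v where v: "v \<in> e0" "v \<in> W" by blast
    obtain u where u: "u \<in> e0" "u \<notin> W" using W(2)[OF e0(1)] by blast
    have "e0 = {u, v}"
      using E[OF e0(1)] u v by (auto simp: card_2_iff)
    then show ?thesis using AB(7)[of "f u" "f v"] fA[of u] fB[of v] u v E[OF e0(1)] e0(3) by auto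
  qed
  show ?thesis
  proof (cases c)
    case Red
    then have "\<forall>e\<in>N. \<alpha> e = Red" "\<forall>e\<in>M. \<alpha> e = Blue"
      using colN colM color.exhaust by blast+
    then show ?thesis unfolding contains_balanced_copy_def
      using sub iso union disj card_eq
      by (intro exI[of _ H] exI[of _ N] exI[of _ M]) auto
  next
    case Blue
    then have "\<forall>e\<in>N. \<alpha> e = Blue" "\<forall>e\<in>M. \<alpha> e = Red"
      using colN colM color.exhaust by blast+
    then show ?thesis unfolding contains_balanced_copy_def
      using sub iso union disj card_eq
      by (intro exI[of _ H] exI[of _ M] exI[of _ N]) auto
  qed
qed

lemma balanceable_if_half_independent:
  assumes G: "simple_graph G"
    and W: "W \<subseteq> verts G" "\<And>e. e \<in> edges G \<Longrightarrow> \<not> e \<subseteq> W"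
    and half: "card {e\<in>edges G. e \<inter> W \<noteq> {}} = card {e\<in>edges G. e \<inter> W = {}}"
  shows "balanceable G"
proof -
  \<comment> \<open>The \<open>+ 1\<close> guarantees \<open>t \<ge> 1\<close> even for an empty
    vertex set.\<close>
  define t where "t = card (verts G) + 1"
  obtain n0 where n0: "\<And>n \<alpha>. n \<ge> n0 \<Longrightarrow>
      (\<And>c. (n choose 2) div 2 \<le> card (color_class n \<alpha> c)) \<Longrightarrow> split_pattern \<alpha> n t"
    using split_pattern_unavoidable[of t] by (auto simp: t_def)
  have "\<exists>m<(n choose 2) div 2. \<forall>\<alpha>. m < card (color_class n \<alpha> Red) \<and>
      m < card (color_class n \<alpha> Blue) \<longrightarrow> contains_balanced_copy n \<alpha> G"
    if n: "n \<ge> n0 + 3" for n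
  \<comment> \<open>With the largest admissible \<open>m\<close>, exceeding it means having at least
    half of the edges, rounded down. For \<open>n \<ge> 3\<close> the subtraction is not
    truncated.\<close>
  proof (intro exI[of _ "(n choose 2) div 2 - 1"] conjI allI impI)
    have "3 * 2 \<le> n * (n - 1)" using n by (intro mult_le_mono) auto
    then have "2 \<le> n choose 2" unfolding choose_two by linarith
    then show "(n choose 2) div 2 - 1 < (n choose 2) div 2" by linarith
    fix \<alpha>
    assume *: "(n choose 2) div 2 - 1 < card (color_class n \<alpha> Red) \<and>
      (n choose 2) div 2 - 1 < card (color_class n \<alpha> Blue)"
    have "(n choose 2) div 2 \<le> card (color_class n \<alpha> c)" for c
      using * by (cases c) auto
    then have "split_pattern \<alpha> n t" using n0 n by simp
    then show "contains_balanced_copy n \<alpha> G"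
      using balanced_copy_of_split_pattern[OF assms] by (simp add: t_def)
  qed
  then show ?thesis unfolding balanceable_def by blast
qed

section \<open>Grids\<close>

lemma verts_grid_graph: "verts (grid_graph k l) = {..<k} \<times> {..<l}"
  by (simp add: grid_graph_def cartesian_product_def path_graph_def)

lemma edges_grid_graph:
  "edges (grid_graph k l) =
     {{(i, j), (Suc i, j)} | i j. Suc i < k \<and> j < l} \<union>
     {{(i, j), (i, Suc j)} | i j. i < k \<and> Suc j < l}"
  (is "?E = ?H \<union> ?V")
proof
  show "?E \<subseteq> ?H \<union> ?V"
    unfolding grid_graph_def cartesian_product_def path_graph_def
    by (auto simp: doubleton_eq_iff)
  show "?H \<union> ?V \<subseteq> ?E"
    unfolding grid_graph_def cartesian_product_def path_graph_def by auto
qed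

section \<open>Rotation and the choice of orbit representatives\<close>

definition grid_rotation :: "nat \<Rightarrow> nat \<Rightarrow> nat \<times> nat \<Rightarrow> nat \<times> nat" where
  "grid_rotation k l = (\<lambda>(i, j). (k - 1 - i, l - 1 - j))"

lemma grid_rotation_invol:
  "p \<in> verts (grid_graph k l) \<Longrightarrow> grid_rotation k l (grid_rotation k l p) = p"
  by (auto simp: verts_grid_graph grid_rotation_def)

lemma grid_rotation_edge:
  assumes "e \<in> edges (grid_graph k l)"
  shows "grid_rotation k l ` e \<in> edges (grid_graph k l)"
proof -
  consider i j where "e = {(i, j), (Suc i, j)}" "Suc i < k" "j < l"
    | i j where "e = {(i, j), (i, Suc j)}" "i < k" "Suc j < l"
    using assms by (auto simp: edges_grid_graph)
  then show ?thesis
  proof cases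
    case 1
    \<comment> \<open>Rotation reverses the edge, so the image of \<open>Suc i\<close> becomes the
      smaller coordinate.\<close>
    then have "k - 1 - i = Suc (k - 2 - i)" "k - 1 - Suc i = k - 2 - i" by auto
    then have "grid_rotation k l ` e = {(k - 2 - i, l - 1 - j), (Suc (k - 2 - i), l - 1 - j)}"
      using 1 by (simp only: grid_rotation_def image_insert image_empty prod.case insert_commute)
    moreover have "Suc (k - 2 - i) < k" "l - 1 - j < l" using 1 by auto
    ultimately show ?thesis unfolding edges_grid_graph by blast
  next
    case 2
    then have "l - 1 - j = Suc (l - 2 - j)" "l - 1 - Suc j = l - 2 - j" by auto
    then have "grid_rotation k l ` e = {(k - 1 - i, l - 2 - j), (k - 1 - i, Suc (l - 2 - j))}"
      using 2 by (simp only: grid_rotation_def image_insert image_empty prod.case insert_commute)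
    moreover have "k - 1 - i < k" "Suc (l - 2 - j) < l" using 2 by auto
    ultimately show ?thesis unfolding edges_grid_graph by blast
  qed
qed

text \<open>
  The summand \<open>(k - 1) div 2 + (l - 1) div 2\<close> selects the bipartition class that avoids the
  centre when \<open>k\<close> and \<open>l\<close> are odd. For even \<open>k\<close> and \<open>l\<close> there is no fixed vertex, and
  either class would do.
\<close>

definition grid_class :: "nat \<Rightarrow> nat \<Rightarrow> (nat \<times> nat) set" where
  "grid_class k l = {(i, j). i < k \<and> j < l \<and> odd (i + j + ((k - 1) div 2 + (l - 1) div 2))}"

text \<open>\<open>2 * i < k - 1\<close> says \<open>i < k - 1 - i\<close>: the chosen vertices
  precede their rotated images lexicographically.\<close>

definition half_class :: "nat \<Rightarrow> nat \<Rightarrow> (nat \<times> nat) set" where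
  "half_class k l =
     {(i, j) \<in> grid_class k l. 2 * i < k - 1 \<or> 2 * i = k - 1 \<and> 2 * j < l - 1}"

lemma half_class_rotation:
  assumes "even k \<longleftrightarrow> even l" "p \<in> verts (grid_graph k l)"
  shows "grid_rotation k l p \<in> half_class k l \<longleftrightarrow> p \<in> grid_class k l \<and> p \<notin> half_class k l"
proof -
  obtain i j where p: "p = (i, j)" "i < k" "j < l"
    using assms by (auto simp: verts_grid_graph)
  define i' j' where "i' = k - 1 - i" and "j' = l - 1 - j"
  have kl: "k = i + i' + 1" "l = j + j' + 1"
    using p by (auto simp: i'_def j'_def)
  have r: "grid_rotation k l p = (i', j')"
    using p by (simp add: grid_rotation_def i'_def j'_def)
  define m where "m = (k - 1) div 2 + (l - 1) div 2"
  \<comment> \<open>The coordinates of a vertex and its image add up to \<open>k + l - 2\<close>,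
    which is even.\<close>
  have parity: "odd (i' + j' + m) \<longleftrightarrow> odd (i + j + m)"
    using assms(1) unfolding kl by simp argo
  \<comment> \<open>At a fixed point \<open>k = 2 * i + 1\<close> and \<open>l = 2 * j + 1\<close>,
    hence \<open>m = i + j\<close>.\<close>
  have centre: "even (i + j + m)" if "i = i'" "j = j'"
    using that unfolding kl m_def by simp
  have "(i, j) \<in> half_class k l \<longleftrightarrow> odd (i + j + m) \<and> (i < i' \<or> i = i' \<and> j < j')"
    unfolding half_class_def grid_class_def m_def[symmetric] by (auto simp: kl)
  moreover have "(i', j') \<in> half_class k l \<longleftrightarrow> odd (i + j + m) \<and> (i' < i \<or> i = i' \<and> j' < j)"
    unfolding half_class_def grid_class_def m_def[symmetric] parity[symmetric] by (auto simp: kl)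
  moreover have "(i, j) \<in> grid_class k l \<longleftrightarrow> odd (i + j + m)"
    unfolding grid_class_def m_def[symmetric] by (auto simp: kl)
  ultimately show ?thesis
    unfolding p(1)[symmetric] r using p(1) centre
    by (metis linorder_neqE_nat order_less_imp_not_less)
qed

lemma grid_edge_class:
  assumes "e \<in> edges (grid_graph k l)"
  obtains p q where "e = {p, q}" "p \<in> grid_class k l" "q \<notin> grid_class k l"
    "p \<in> verts (grid_graph k l)" "q \<in> verts (grid_graph k l)"
proof -
  let ?C = "grid_class k l"
  consider i j where "e = {(i, j), (Suc i, j)}" "Suc i < k" "j < l"
    | i j where "e = {(i, j), (i, Suc j)}" "i < k" "Suc j < l"
    using assms by (auto simp: edges_grid_graph)
  then show thesis
  proof cases
    case 1
    then have "(i, j) \<in> ?C \<longleftrightarrow> (Suc i, j) \<notin> ?C" by (auto simp: grid_class_def)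
    then show ?thesis
      using 1 that[of "(i, j)" "(Suc i, j)"] that[of "(Suc i, j)" "(i, j)"]
      by (auto simp: verts_grid_graph insert_commute)
  next
    case 2
    then have "(i, j) \<in> ?C \<longleftrightarrow> (i, Suc j) \<notin> ?C" by (auto simp: grid_class_def)
    then show ?thesis
      using 2 that[of "(i, j)" "(i, Suc j)"] that[of "(i, Suc j)" "(i, j)"]
      by (auto simp: verts_grid_graph insert_commute)
  qed
qed

lemma card_edges_half_class:
  assumes "even k \<longleftrightarrow> even l"
  shows "card {e \<in> edges (grid_graph k l). e \<inter> half_class k l \<noteq> {}} =
    card {e \<in> edges (grid_graph k l). e \<inter> half_class k l = {}}"
proof (rule bij_betw_same_card)
  let ?\<rho> = "grid_rotation k l" and ?W = "half_class k l" and ?E = "edges (grid_graph k l)"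
  have invol: "?\<rho> ` ?\<rho> ` e = e" if e: "e \<in> ?E" for e
  proof -
    obtain p q where "e = {p, q}" "p \<in> verts (grid_graph k l)" "q \<in> verts (grid_graph k l)"
      using grid_edge_class[OF e] by blast
    then show ?thesis using grid_rotation_invol by simp
  qed
  have flip: "?\<rho> ` e \<inter> ?W \<noteq> {} \<longleftrightarrow> e \<inter> ?W = {}" if e: "e \<in> ?E" for e
  proof -
    obtain p q where pq: "e = {p, q}" "p \<in> grid_class k l" "q \<notin> grid_class k l"
      "p \<in> verts (grid_graph k l)" "q \<in> verts (grid_graph k l)"
      using grid_edge_class[OF e] .
    have "q \<notin> ?W" using pq by (auto simp: half_class_def)
    \<comment> \<open>Neither \<open>q\<close> nor its image lies in \<open>?W\<close>, so only
      \<open>p\<close> matters, and exactly one of \<open>p\<close> and its image is chosen.\<close>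
    then show ?thesis
      using half_class_rotation[OF assms pq(4)] half_class_rotation[OF assms pq(5)] pq by auto
  qed
  show "bij_betw ((`) ?\<rho>) {e \<in> ?E. e \<inter> ?W \<noteq> {}} {e \<in> ?E. e \<inter> ?W = {}}"
    by (rule bij_betw_byWitness[where f' = "(`) ?\<rho>"])
      (use invol flip grid_rotation_edge in auto)
qed

theorem theorem20:
  fixes k l :: nat
  assumes "k > 1" and "l > 1"
    and "even k \<longleftrightarrow> even l"
  shows "balanceable (grid_graph k l)"
proof (rule balanceable_if_half_independent)
  show "simple_graph (grid_graph k l)" by (rule simple_graph_grid_graph)
  show "half_class k l \<subseteq> verts (grid_graph k l)"
    by (auto simp: half_class_def grid_class_def verts_grid_graph)
  show "\<not> e \<subseteq> half_class k l" if "e \<in> edges (grid_graph k l)" for e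
    using grid_edge_class[OF that] by (auto simp: half_class_def)
qed (rule card_edges_half_class[OF assms(3)])

end
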